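(* Let $(P,\le,0,{}^* )$ be a pseudocomplemented poset and let $\alpha,\beta\in P$ be $*$-closed elements. Let $f,g\colon P\to P$ be mappings such that for every $a\in P$: - if $a\le\alpha$ then $f(a)=0$, and if $a\not\le\alpha$ then $f(a)$ is an element of $P$ satisfying $(f(a))^*=\beta$; - if $a\le\beta$ then $g(a)=0$, and if $a\not\le\beta$ then $g(a)$ is an element of $P$ satisfying $(g(a))^*=\alpha$. Then $f$ and $g$ are orthogonally adjoint.
   Context: Let $(P,\le,0)$ be a poset with least element $0$. For $x,y\in P$, $x\wedge y=0$ means that the infimum of $x,y$ exists and equals $0$ (i.e. $0$ is the only common lower bound of $x$ and $y$); this is also written $x\perp y$. Put $a^\perp:=\{x\in P\mid x\wedge a=0\}$. The poset is pseudocomplemented if for each $a\in P$ the set $a^\perp$ has a greatest element, denoted $a^*$. An element $a$ is $*$-closed if $a^{**}=a$ (equivalently, $a=b^*$ for some $b\in P$). Mappings $f,g\colon P\to P$ are orthogonally adjoint if for all $x,y\in P$: $f(x)\wedge y=0$ if and only if $x\wedge g(y)=0$. *)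

theory Defs
  imports Main
begin

context order_bot
begin

definition is_meet :: "'a \<Rightarrow> 'a \<Rightarrow> 'a \<Rightarrow> bool" where
  "is_meet x y m \<longleftrightarrow> m \<le> x \<and> m \<le> y \<and> (\<forall>z. z \<le> x \<and> z \<le> y \<longrightarrow> z \<le> m)"

text \<open>The order is not assumed to be a semilattice, so \<open>x \<and> y = 0\<close> asserts both that the
  infimum of \<open>x\<close> and \<open>y\<close> exists and that it is the least element.\<close>

definition orth :: "'a \<Rightarrow> 'a \<Rightarrow> bool" (infix "\<bottom>\<bottom>" 50) where
  "x \<bottom>\<bottom> y \<longleftrightarrow> is_meet x y bot"

definition perp :: "'a \<Rightarrow> 'a set" where
  "perp a = {x. x \<bottom>\<bottom> a}"

lemma orth_iff: "x \<bottom>\<bottom> y \<longleftrightarrow> (\<forall>z. z \<le> x \<and> z \<le> y \<longrightarrow> z = bot)"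
  by (auto simp: orth_def is_meet_def bot_unique)

definition orthogonally_adjoint :: "('a \<Rightarrow> 'a) \<Rightarrow> ('a \<Rightarrow> 'a) \<Rightarrow> bool" where
  "orthogonally_adjoint f g \<longleftrightarrow> (\<forall>x y. f x \<bottom>\<bottom> y \<longleftrightarrow> x \<bottom>\<bottom> g y)"

end

class pseudocomplemented_poset = order_bot +
  assumes ex_greatest_perp: "\<exists>m. m \<in> perp a \<and> (\<forall>x \<in> perp a. x \<le> m)"
begin

definition pcompl :: "'a \<Rightarrow> 'a" where
  "pcompl a = (GREATEST x. x \<in> perp a)"

definition star_closed :: "'a \<Rightarrow> bool" where
  "star_closed a \<longleftrightarrow> pcompl (pcompl a) = a"

lemma pcompl_in_perp: "pcompl a \<in> perp a"
  and pcompl_greatest: "x \<in> perp a \<Longrightarrow> x \<le> pcompl a"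
proof -
  obtain m where m: "m \<in> perp a" "\<And>x. x \<in> perp a \<Longrightarrow> x \<le> m"
    using ex_greatest_perp by blast
  then have "pcompl a = m"
    unfolding pcompl_def by (intro Greatest_equality) auto
  with m show "pcompl a \<in> perp a" and "x \<in> perp a \<Longrightarrow> x \<le> pcompl a"
    by auto
qed

lemma star_closed_iff_range: "star_closed a \<longleftrightarrow> (\<exists>b. a = pcompl b)"
proof
  assume "star_closed a"
  then show "\<exists>b. a = pcompl b" unfolding star_closed_def by metis
next
  have sym: "x \<in> perp y \<longleftrightarrow> y \<in> perp x" for x y
    by (auto simp: perp_def orth_iff)
  have le: "x \<le> pcompl (pcompl x)" for x
    using pcompl_in_perp pcompl_greatest sym by blast
  have anti: "pcompl y \<le> pcompl x" if "x \<le> y" for x y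
    using pcompl_in_perp[of y] that
    by (intro pcompl_greatest) (auto simp: perp_def orth_iff intro: order_trans)
  assume "\<exists>b. a = pcompl b"
  then show "star_closed a"
    unfolding star_closed_def using le anti by (metis order.antisym)
qed

end

end

theory Submission
  imports Defs
begin

text \<open>Since \<open>x \<bottom>\<bottom> y\<close> means \<open>x \<le> y\<^sup>*\<close>, both \<open>f x \<bottom>\<bottom> y\<close> and \<open>x \<bottom>\<bottom> g y\<close> are equivalent to the
  condition \<open>x \<le> \<alpha> \<or> y \<le> \<beta>\<close>.\<close>

lemma (in order_bot) orth_commute: "x \<bottom>\<bottom> y \<longleftrightarrow> y \<bottom>\<bottom> x"
  by (auto simp: orth_iff)

lemma (in order_bot) bot_orth: "bot \<bottom>\<bottom> x"
  by (auto simp: orth_iff bot_unique)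

text \<open>\<open>perp y\<close> is closed downwards and contains its greatest element
  \<open>pcompl y\<close>, so it is the principal ideal generated by
  \<open>pcompl y\<close>.\<close>

lemma (in pseudocomplemented_poset) orth_iff_le_pcompl: "x \<bottom>\<bottom> y \<longleftrightarrow> x \<le> pcompl y"
proof
  show "x \<le> pcompl y" if "x \<bottom>\<bottom> y"
    using that by (simp add: pcompl_greatest perp_def)
  show "x \<bottom>\<bottom> y" if "x \<le> pcompl y"
    using that pcompl_in_perp[of y] by (auto simp: perp_def orth_iff intro: order_trans)
qed

text \<open>If x \<le> \<alpha>, then \<open>f x\<close> is \<open>bot\<close>, which is orthogonal
  to everything; otherwise the condition is y \<le> \<open>pcompl (f x)\<close> = \<beta>. Only one
  map occurs, so that the lemma serves both f and g.\<close>

lemma (in pseudocomplemented_poset) orth_step_iff: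
  assumes "\<And>a. a \<le> \<alpha> \<Longrightarrow> f a = bot"
    and "\<And>a. \<not> a \<le> \<alpha> \<Longrightarrow> pcompl (f a) = \<beta>"
  shows "y \<bottom>\<bottom> f x \<longleftrightarrow> x \<le> \<alpha> \<or> y \<le> \<beta>"
proof (cases "x \<le> \<alpha>")
  case True
  then show ?thesis using assms(1) bot_orth orth_commute by metis
next
  case False
  then show ?thesis using assms(2) orth_iff_le_pcompl by simp
qed

theorem theorem12:
  fixes \<alpha> \<beta> :: "'a::pseudocomplemented_poset"
    and f g :: "'a \<Rightarrow> 'a"
  assumes "star_closed \<alpha>" and "star_closed \<beta>"
    and "\<And>a. a \<le> \<alpha> \<Longrightarrow> f a = bot"
    and "\<And>a. \<not> a \<le> \<alpha> \<Longrightarrow> pcompl (f a) = \<beta>"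
    and "\<And>a. a \<le> \<beta> \<Longrightarrow> g a = bot"
    and "\<And>a. \<not> a \<le> \<beta> \<Longrightarrow> pcompl (g a) = \<alpha>"
  shows "orthogonally_adjoint f g"
  unfolding orthogonally_adjoint_def
proof (intro allI)
  fix x y
  have "f x \<bottom>\<bottom> y \<longleftrightarrow> x \<le> \<alpha> \<or> y \<le> \<beta>"
    using orth_step_iff[of \<alpha> f \<beta> y x, OF assms(3,4)] orth_commute by blast
  \<comment> \<open>For g the roles of \<alpha> and \<beta>, and of x and y, are exchanged; the
    disjunction is symmetric under this exchange.\<close>
  also have "\<dots> \<longleftrightarrow> x \<bottom>\<bottom> g y"
    using orth_step_iff[of \<beta> g \<alpha> x y, OF assms(5,6)] by blast
  finally show "f x \<bottom>\<bottom> y \<longleftrightarrow> x \<bottom>\<bottom> g y" .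
qed

end
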